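(* Every two-dimensional non-linear sigma model with target manifold $M$ (of dimension $n$) and background field $E\in\Gamma(T^*M\otimes T^*M)$ can be locally gauged when $E$ is invertible.
   Context: A two-dimensional non-linear sigma model consists of data $(X,\Sigma,h,E,H,S_Q[X])$: an embedding $X:\Sigma\to M$ of a two-dimensional (pseudo-)Riemannian surface $(\Sigma,h)$ into an $n$-dimensional target manifold $M$, a field $E=G+C\in\Gamma(T^*M\otimes T^*M)$ with $G$ a (pseudo-)Riemannian metric and $C$ a $2$-form, a $3$-form $H\in\Omega^3(M)$, and an action functional. Only $E$ enters the conditions below. Invertible means the matrix $(E_{\mu\nu})$ is invertible at each point. Notation (local coordinates, summation convention, $\mu,\nu,\lambda=1,\dots,n$; $a,b,c=1,\dots,k$): for vector fields $\rho_a=\rho^\mu_a\partial_\mu$, $\rho$ is the $n\times k$ matrix $(\rho^\mu_a)$; involutive means $[\rho_a,\rho_b]=C^c{}_{ab}\rho_c$ with smooth functions $C^c{}_{ab}$; $\rho^+=(\rho^T\rho)^{-1}\rho^T$ and $(E\rho)^+=(\rho^TE^TE\rho)^{-1}\rho^TE^T$. $Q_U\to U$ is a rank-$k$ vector bundle with frame $\{e_a\}$, bracket $[e_a,e_b]_Q=C^c{}_{ab}e_c$ and anchor $\rho(e_a)=\rho_a$. $TU$-connections $\nabla^\pm$ on $Q_U$ have coefficients $\nabla^\pm e_a=(\Omega^\pm)^b{}_a\otimes e_b$; their adjoint $Q$-connections are ${}^Q\nabla^\pm_{q_1}q_2=\nabla^\pm_{\rho(q_2)}q_1+[q_1,q_2]_Q$,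 with coefficients $({}^Q\Omega^\pm)^a{}_{bc}=\rho^\mu_c(\Omega^\pm)^a{}_{\mu b}+C^a{}_{bc}$. Flat means $\nabla_{q_1}\nabla_{q_2}q_3-\nabla_{q_2}\nabla_{q_1}q_3-\nabla_{[q_1,q_2]_Q}q_3=0$. Definition (locally gauged). The sigma model can be locally gauged when there exist some (nonempty open) $U\subset M$, vector fields $\rho_a\in\Gamma(TU)$ and ${}^Q\Omega^\pm\in\Gamma(Q_U^*\otimes\mathrm{End}(Q_U))$ such that on $U$: (i) the $\rho_a$ ($a=1,\dots,k$, $k\ge1$) are linearly independent at each point and involutive; (ii) $\Psi_a=E\rho(E\rho)^+\Psi_a$ and $\det(\rho^TE\rho)\ne0$, where $(\Psi_a)_{\mu\nu}=(\mathcal{L}_{\rho_a}E)_{\mu\nu}+E_{\lambda\nu}\rho^\lambda_bC^b{}_{ac}(\rho^+)^c_\mu$; (iii) ${}^Q\Omega^\pm$ are the coefficients of flat adjoint connections ${}^Q\nabla^\pm$ of connections $\nabla^\pm$ whose coefficients solve the generalised Killing equation $(\mathcal{L}_{\rho_a}E)_{\mu\nu}=E_{\mu\lambda}\rho^\lambda_b(\Omega^+)^b{}_{\nu a}+E_{\lambda\nu}\rho^\lambda_b(\Omega^-)^b{}_{\mu a}$. *)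

theory Defs
  imports
    "Jordan_Normal_Form.Gauss_Jordan_Elimination"
    "Jordan_Normal_Form.Determinant"
    "HOL-Analysis.Analysis"
begin

no_notation vec_index (infixl \<open>$\<close> 100)


section \<open>Smooth maps between open sets of normed spaces\<close>

text \<open>These are meant for open \<open>S\<close>. The condition for \<open>Suc m\<close> says that all directional
  derivatives are \<open>m\<close> times continuously differentiable.\<close>

fun Ck_on :: "nat \<Rightarrow> ('a::real_normed_vector \<Rightarrow> 'b::real_normed_vector) \<Rightarrow> 'a set \<Rightarrow> bool" where
  "Ck_on 0 f S \<longleftrightarrow> continuous_on S f"
| "Ck_on (Suc m) f S \<longleftrightarrow>
     (\<forall>x\<in>S. f differentiable (at x)) \<and> (\<forall>v. Ck_on m (\<lambda>x. frechet_derivative f (at x) v) S)"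

definition smooth_on :: "'a::real_normed_vector set \<Rightarrow> ('a \<Rightarrow> 'b::real_normed_vector) \<Rightarrow> bool" where
  "smooth_on S f \<longleftrightarrow> (\<forall>m. Ck_on m f S)"

definition partial :: "'n::finite \<Rightarrow> (real^'n \<Rightarrow> 'b::real_normed_vector) \<Rightarrow> real^'n \<Rightarrow> 'b" where
  "partial \<mu> f x = frechet_derivative f (at x) (axis \<mu> 1)"


section \<open>Smooth manifolds of dimension \<open>CARD('n)\<close>\<close>

text \<open>A chart is a pair of its domain and a coordinate map; the values of the coordinate map
  outside the domain are irrelevant.\<close>

type_synonym ('m, 'n) chart = "'m set \<times> ('m \<Rightarrow> real^'n)"

definition chart_range :: "('m, 'n::finite) chart \<Rightarrow> (real^'n) set" where
  "chart_range c = snd c ` fst c"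

definition is_chart :: "'m topology \<Rightarrow> ('m, 'n::finite) chart \<Rightarrow> bool" where
  "is_chart M c \<longleftrightarrow> openin M (fst c) \<and> open (chart_range c) \<and>
     homeomorphic_map (subtopology M (fst c)) (top_of_set (chart_range c)) (snd c)"

definition transition :: "('m, 'n::finite) chart \<Rightarrow> ('m, 'n) chart \<Rightarrow> real^'n \<Rightarrow> real^'n" where
  "transition c d = snd d \<circ> inv_into (fst c) (snd c)"

definition smooth_transition :: "('m, 'n::finite) chart \<Rightarrow> ('m, 'n) chart \<Rightarrow> bool" where
  "smooth_transition c d \<longleftrightarrow> smooth_on (snd c ` (fst c \<inter> fst d)) (transition c d)"

text \<open>The smooth structure is given by its maximal atlas \<open>A\<close>.\<close>

definition smooth_manifold :: "'m topology \<Rightarrow> ('m, 'n::finite) chart set \<Rightarrow> bool" where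
  "smooth_manifold M A \<longleftrightarrow>
     Hausdorff_space M \<and> second_countable M \<and>
     (\<forall>c\<in>A. is_chart M c) \<and>
     topspace M = (\<Union>c\<in>A. fst c) \<and>
     (\<forall>c\<in>A. \<forall>d\<in>A. smooth_transition c d) \<and>
     (\<forall>c. is_chart M c \<and> (\<forall>d\<in>A. smooth_transition c d \<and> smooth_transition d c) \<longrightarrow> c \<in> A)"


section \<open>Covariant 2-tensor fields\<close>

text \<open>A section of \<open>T\<^sup>*M \<otimes> T\<^sup>*M\<close> is given by its component matrices
  \<open>E c x $ \<mu> $ \<nu>\<close> in every chart \<open>c\<close>, as functions of the coordinates \<open>x\<close>; the components in
  different charts are related by the tensor transformation law.\<close>

type_synonym ('m, 'n) tensor2 = "('m, 'n) chart \<Rightarrow> real^'n \<Rightarrow> real^'n^'n"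

definition tensor_field2 :: "('m, 'n::finite) chart set \<Rightarrow> ('m, 'n) tensor2 \<Rightarrow> bool" where
  "tensor_field2 A E \<longleftrightarrow>
     (\<forall>c\<in>A. smooth_on (chart_range c) (E c)) \<and>
     (\<forall>c\<in>A. \<forall>d\<in>A. \<forall>x\<in>snd c ` (fst c \<inter> fst d). \<forall>\<mu> \<nu>.
        E c x $ \<mu> $ \<nu> =
          (\<Sum>\<kappa>\<in>UNIV. \<Sum>\<sigma>\<in>UNIV. E d (transition c d x) $ \<kappa> $ \<sigma> *
             partial \<mu> (transition c d) x $ \<kappa> * partial \<nu> (transition c d) x $ \<sigma>))"

definition pseudo_riemannian_metric ::
    "('m, 'n::finite) chart set \<Rightarrow> ('m, 'n) tensor2 \<Rightarrow> bool" where
  "pseudo_riemannian_metric A G \<longleftrightarrow> tensor_field2 A G \<and>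
     (\<forall>c\<in>A. \<forall>x\<in>chart_range c.
        (\<forall>\<mu> \<nu>. G c x $ \<mu> $ \<nu> = G c x $ \<nu> $ \<mu>) \<and> invertible (G c x))"

definition two_form :: "('m, 'n::finite) chart set \<Rightarrow> ('m, 'n) tensor2 \<Rightarrow> bool" where
  "two_form A C \<longleftrightarrow> tensor_field2 A C \<and>
     (\<forall>c\<in>A. \<forall>x\<in>chart_range c. \<forall>\<mu> \<nu>. C c x $ \<mu> $ \<nu> = - (C c x $ \<nu> $ \<mu>))"

text \<open>The background field \<open>E = G + C\<close> of a sigma model. The remaining data of the model
  (\<open>X\<close>, \<open>\<Sigma>\<close>, \<open>h\<close>, \<open>H\<close> and the action functional) do not enter the gauging conditions.\<close>

definition sigma_model_background ::
    "('m, 'n::finite) chart set \<Rightarrow> ('m, 'n) tensor2 \<Rightarrow> bool" where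
  "sigma_model_background A E \<longleftrightarrow> tensor_field2 A E \<and>
     (\<exists>G C. pseudo_riemannian_metric A G \<and> two_form A C \<and>
        (\<forall>c\<in>A. \<forall>x\<in>chart_range c. E c x = G c x + C c x))"

definition invertible_field :: "('m, 'n::finite) chart set \<Rightarrow> ('m, 'n) tensor2 \<Rightarrow> bool" where
  "invertible_field A E \<longleftrightarrow> (\<forall>c\<in>A. \<forall>x\<in>chart_range c. invertible (E c x))"


section \<open>Local calculus in a coordinate domain\<close>

definition lie_bracket :: "(real^'n::finite \<Rightarrow> real^'n) \<Rightarrow> (real^'n \<Rightarrow> real^'n) \<Rightarrow> real^'n \<Rightarrow> real^'n" where
  "lie_bracket V W x =
     (\<Sum>\<sigma>\<in>UNIV. (V x $ \<sigma>) *\<^sub>R partial \<sigma> W x - (W x $ \<sigma>) *\<^sub>R partial \<sigma> V x)"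

definition lie_derivative2 ::
    "(real^'n::finite \<Rightarrow> real^'n) \<Rightarrow> (real^'n \<Rightarrow> real^'n^'n) \<Rightarrow> real^'n \<Rightarrow> real^'n^'n" where
  "lie_derivative2 V E x = (\<chi> \<mu> \<nu>. \<Sum>\<sigma>\<in>UNIV.
     V x $ \<sigma> * partial \<sigma> E x $ \<mu> $ \<nu> +
     E x $ \<sigma> $ \<nu> * partial \<mu> V x $ \<sigma> +
     E x $ \<mu> $ \<sigma> * partial \<nu> V x $ \<sigma>)"

text \<open>An \<open>n \<times> k\<close> matrix is represented by its columns \<open>v 0, \<dots>, v (k - 1)\<close>;
  \<open>gram k v\<close> is \<open>v\<^sup>T v\<close>, and \<open>pinv k v a\<close> is row \<open>a\<close> of \<open>v\<^sup>+ = (v\<^sup>T v)\<^sup>-\<^sup>1 v\<^sup>T\<close>.\<close>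

definition gram :: "nat \<Rightarrow> (nat \<Rightarrow> real^'n::finite) \<Rightarrow> real Matrix.mat" where
  "gram k v = Matrix.mat k k (\<lambda>(a, b). inner (v a) (v b))"

definition pinv :: "nat \<Rightarrow> (nat \<Rightarrow> real^'n::finite) \<Rightarrow> nat \<Rightarrow> real^'n" where
  "pinv k v a = (\<Sum>b<k. (the (mat_inverse (gram k v)) $$ (a, b)) *\<^sub>R v b)"

text \<open>Below, \<open>\<rho> a x $ \<mu>\<close> is \<open>\<rho>\<^sup>\<mu>\<^sub>a\<close>, \<open>C c a b\<close> is \<open>C\<^sup>c\<^sub>a\<^sub>b\<close>
  (with \<open>[\<rho>\<^sub>a, \<rho>\<^sub>b] = C\<^sup>c\<^sub>a\<^sub>b \<rho>\<^sub>c\<close>), and \<open>\<Omega> b \<mu> a\<close> is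
  \<open>\<Omega>\<^sup>b\<^sub>\<mu>\<^sub>a\<close>. Indices \<open>a, b, c\<close> range over \<open>{..<k}\<close>; values at other indices are ignored.\<close>

definition linearly_independent_at :: "nat \<Rightarrow> (nat \<Rightarrow> real^'n::finite \<Rightarrow> real^'n) \<Rightarrow> real^'n \<Rightarrow> bool" where
  "linearly_independent_at k \<rho> x \<longleftrightarrow>
     inj_on (\<lambda>a. \<rho> a x) {..<k} \<and> independent ((\<lambda>a. \<rho> a x) ` {..<k})"

definition involutive_on :: "(real^'n::finite) set \<Rightarrow> nat \<Rightarrow> (nat \<Rightarrow> real^'n \<Rightarrow> real^'n) \<Rightarrow>
    (nat \<Rightarrow> nat \<Rightarrow> nat \<Rightarrow> real^'n \<Rightarrow> real) \<Rightarrow> bool" where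
  "involutive_on S k \<rho> C \<longleftrightarrow>
     (\<forall>a<k. \<forall>b<k. \<forall>c<k. smooth_on S (C c a b)) \<and>
     (\<forall>a<k. \<forall>b<k. \<forall>x\<in>S. lie_bracket (\<rho> a) (\<rho> b) x = (\<Sum>c<k. C c a b x *\<^sub>R \<rho> c x))"

definition Psi :: "nat \<Rightarrow> (nat \<Rightarrow> real^'n::finite \<Rightarrow> real^'n) \<Rightarrow> (nat \<Rightarrow> nat \<Rightarrow> nat \<Rightarrow> real^'n \<Rightarrow> real) \<Rightarrow>
    (real^'n \<Rightarrow> real^'n^'n) \<Rightarrow> nat \<Rightarrow> real^'n \<Rightarrow> real^'n^'n" where
  "Psi k \<rho> C E a x = (\<chi> \<mu> \<nu>. lie_derivative2 (\<rho> a) E x $ \<mu> $ \<nu> +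
     (\<Sum>\<sigma>\<in>UNIV. \<Sum>b<k. \<Sum>c<k.
        E x $ \<sigma> $ \<nu> * \<rho> b x $ \<sigma> * C b a c x * pinv k (\<lambda>d. \<rho> d x) c $ \<mu>))"

definition Erho :: "(nat \<Rightarrow> real^'n::finite \<Rightarrow> real^'n) \<Rightarrow> (real^'n \<Rightarrow> real^'n^'n) \<Rightarrow>
    real^'n \<Rightarrow> nat \<Rightarrow> real^'n" where
  "Erho \<rho> E x a = E x *v \<rho> a x"

definition Psi_condition :: "(real^'n::finite) set \<Rightarrow> nat \<Rightarrow> (nat \<Rightarrow> real^'n \<Rightarrow> real^'n) \<Rightarrow>
    (nat \<Rightarrow> nat \<Rightarrow> nat \<Rightarrow> real^'n \<Rightarrow> real) \<Rightarrow> (real^'n \<Rightarrow> real^'n^'n) \<Rightarrow> bool" where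
  "Psi_condition S k \<rho> C E \<longleftrightarrow> (\<forall>x\<in>S.
     (\<forall>a<k. \<forall>\<mu> \<nu>. Psi k \<rho> C E a x $ \<mu> $ \<nu> =
        (\<Sum>b<k. \<Sum>\<sigma>\<in>UNIV. Erho \<rho> E x b $ \<mu> * pinv k (Erho \<rho> E x) b $ \<sigma> *
           Psi k \<rho> C E a x $ \<sigma> $ \<nu>)) \<and>
     Determinant.det (Matrix.mat k k (\<lambda>(a, b). inner (\<rho> a x) (Erho \<rho> E x b))) \<noteq> 0)"


section \<open>The bundle \<open>Q\<^sub>U\<close> and its connections\<close>

text \<open>A section \<open>q = q\<^sup>a e\<^sub>a\<close> of \<open>Q\<^sub>U\<close> is represented by its components \<open>q a\<close> in the frame.\<close>

type_synonym 'n sect = "nat \<Rightarrow> real^'n \<Rightarrow> real"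

definition smooth_section :: "(real^'n::finite) set \<Rightarrow> nat \<Rightarrow> 'n sect \<Rightarrow> bool" where
  "smooth_section S k q \<longleftrightarrow> (\<forall>a<k. smooth_on S (q a))"

definition anchor :: "nat \<Rightarrow> (nat \<Rightarrow> real^'n::finite \<Rightarrow> real^'n) \<Rightarrow> 'n sect \<Rightarrow> real^'n \<Rightarrow> real^'n" where
  "anchor k \<rho> q x = (\<Sum>a<k. q a x *\<^sub>R \<rho> a x)"

text \<open>The bracket is the extension of \<open>[e\<^sub>a, e\<^sub>b]\<^sub>Q = C\<^sup>c\<^sub>a\<^sub>b e\<^sub>c\<close>
  to all sections by antisymmetry and the Leibniz rule
  \<open>[q, f r]\<^sub>Q = f [q, r]\<^sub>Q + (\<rho>(q) f) r\<close>.\<close>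

definition Q_bracket :: "nat \<Rightarrow> (nat \<Rightarrow> real^'n::finite \<Rightarrow> real^'n) \<Rightarrow>
    (nat \<Rightarrow> nat \<Rightarrow> nat \<Rightarrow> real^'n \<Rightarrow> real) \<Rightarrow> 'n sect \<Rightarrow> 'n sect \<Rightarrow> 'n sect" where
  "Q_bracket k \<rho> C q r c x =
     (\<Sum>a<k. \<Sum>b<k. q a x * r b x * C c a b x) +
     (\<Sum>\<mu>\<in>UNIV. anchor k \<rho> q x $ \<mu> * partial \<mu> (r c) x - anchor k \<rho> r x $ \<mu> * partial \<mu> (q c) x)"

definition TU_conn :: "nat \<Rightarrow> (nat \<Rightarrow> 'n \<Rightarrow> nat \<Rightarrow> real^'n::finite \<Rightarrow> real) \<Rightarrow>
    (real^'n \<Rightarrow> real^'n) \<Rightarrow> 'n sect \<Rightarrow> 'n sect" where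
  "TU_conn k \<Omega> V q a x =
     (\<Sum>\<mu>\<in>UNIV. V x $ \<mu> * (partial \<mu> (q a) x + (\<Sum>b<k. \<Omega> a \<mu> b x * q b x)))"

definition adjoint_conn :: "nat \<Rightarrow> (nat \<Rightarrow> real^'n::finite \<Rightarrow> real^'n) \<Rightarrow>
    (nat \<Rightarrow> nat \<Rightarrow> nat \<Rightarrow> real^'n \<Rightarrow> real) \<Rightarrow> (nat \<Rightarrow> 'n \<Rightarrow> nat \<Rightarrow> real^'n \<Rightarrow> real) \<Rightarrow>
    'n sect \<Rightarrow> 'n sect \<Rightarrow> 'n sect" where
  "adjoint_conn k \<rho> C \<Omega> q r a x = TU_conn k \<Omega> (anchor k \<rho> r) q a x + Q_bracket k \<rho> C q r a x"

definition adjoint_coeff :: "(nat \<Rightarrow> real^'n::finite \<Rightarrow> real^'n) \<Rightarrow>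
    (nat \<Rightarrow> nat \<Rightarrow> nat \<Rightarrow> real^'n \<Rightarrow> real) \<Rightarrow> (nat \<Rightarrow> 'n \<Rightarrow> nat \<Rightarrow> real^'n \<Rightarrow> real) \<Rightarrow>
    nat \<Rightarrow> nat \<Rightarrow> nat \<Rightarrow> real^'n \<Rightarrow> real" where
  "adjoint_coeff \<rho> C \<Omega> a b c x = (\<Sum>\<mu>\<in>UNIV. \<rho> c x $ \<mu> * \<Omega> a \<mu> b x) + C a b c x"

definition flat_Q_conn :: "(real^'n::finite) set \<Rightarrow> nat \<Rightarrow> ('n sect \<Rightarrow> 'n sect \<Rightarrow> 'n sect) \<Rightarrow>
    ('n sect \<Rightarrow> 'n sect \<Rightarrow> 'n sect) \<Rightarrow> bool" where
  "flat_Q_conn S k br D \<longleftrightarrow>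
     (\<forall>q1 q2 q3. smooth_section S k q1 \<and> smooth_section S k q2 \<and> smooth_section S k q3 \<longrightarrow>
        (\<forall>a<k. \<forall>x\<in>S. D q1 (D q2 q3) a x - D q2 (D q1 q3) a x - D (br q1 q2) q3 a x = 0))"

definition generalised_killing :: "(real^'n::finite) set \<Rightarrow> nat \<Rightarrow> (nat \<Rightarrow> real^'n \<Rightarrow> real^'n) \<Rightarrow>
    (real^'n \<Rightarrow> real^'n^'n) \<Rightarrow> (nat \<Rightarrow> 'n \<Rightarrow> nat \<Rightarrow> real^'n \<Rightarrow> real) \<Rightarrow>
    (nat \<Rightarrow> 'n \<Rightarrow> nat \<Rightarrow> real^'n \<Rightarrow> real) \<Rightarrow> bool" where
  "generalised_killing S k \<rho> E \<Omega>p \<Omega>m \<longleftrightarrow> (\<forall>a<k. \<forall>x\<in>S. \<forall>\<mu> \<nu>.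
     lie_derivative2 (\<rho> a) E x $ \<mu> $ \<nu> =
       (\<Sum>\<sigma>\<in>UNIV. \<Sum>b<k. E x $ \<mu> $ \<sigma> * \<rho> b x $ \<sigma> * \<Omega>p b \<nu> a x) +
       (\<Sum>\<sigma>\<in>UNIV. \<Sum>b<k. E x $ \<sigma> $ \<nu> * \<rho> b x $ \<sigma> * \<Omega>m b \<mu> a x))"


section \<open>Local gauging\<close>

text \<open>\<open>S\<close> is the coordinate range of the domain \<open>U\<close>; \<open>Wp\<close>, \<open>Wm\<close> are the coefficients
  of the adjoint connections, \<open>\<Omega>p\<close>, \<open>\<Omega>m\<close> those of the \<open>TU\<close>-connections.\<close>

definition gauging_data :: "(real^'n::finite) set \<Rightarrow> (real^'n \<Rightarrow> real^'n^'n) \<Rightarrow> nat \<Rightarrow>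
    (nat \<Rightarrow> real^'n \<Rightarrow> real^'n) \<Rightarrow> (nat \<Rightarrow> nat \<Rightarrow> nat \<Rightarrow> real^'n \<Rightarrow> real) \<Rightarrow>
    (nat \<Rightarrow> nat \<Rightarrow> nat \<Rightarrow> real^'n \<Rightarrow> real) \<Rightarrow> bool" where
  "gauging_data S E k \<rho> Wp Wm \<longleftrightarrow>
     (\<forall>a<k. smooth_on S (\<rho> a)) \<and>
     (\<forall>a<k. \<forall>b<k. \<forall>c<k. smooth_on S (Wp a b c) \<and> smooth_on S (Wm a b c)) \<and>
     (\<forall>x\<in>S. linearly_independent_at k \<rho> x) \<and>
     (\<exists>C. involutive_on S k \<rho> C \<and>
        Psi_condition S k \<rho> C E \<and>
        (\<exists>\<Omega>p \<Omega>m.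
           (\<forall>a<k. \<forall>\<mu>. \<forall>b<k. smooth_on S (\<Omega>p a \<mu> b) \<and> smooth_on S (\<Omega>m a \<mu> b)) \<and>
           (\<forall>a<k. \<forall>b<k. \<forall>c<k. \<forall>x\<in>S.
              Wp a b c x = adjoint_coeff \<rho> C \<Omega>p a b c x \<and>
              Wm a b c x = adjoint_coeff \<rho> C \<Omega>m a b c x) \<and>
           flat_Q_conn S k (Q_bracket k \<rho> C) (adjoint_conn k \<rho> C \<Omega>p) \<and>
           flat_Q_conn S k (Q_bracket k \<rho> C) (adjoint_conn k \<rho> C \<Omega>m) \<and>
           generalised_killing S k \<rho> E \<Omega>p \<Omega>m))"

text \<open>The conditions are stated in local coordinates (\<open>\<rho>\<^sup>+\<close> depends on them), so \<open>U\<close> is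
  the domain of a chart of the smooth structure.\<close>

definition locally_gauged :: "('m, 'n::finite) chart set \<Rightarrow> ('m, 'n) tensor2 \<Rightarrow> bool" where
  "locally_gauged A E \<longleftrightarrow>
     (\<exists>c\<in>A. fst c \<noteq> {} \<and>
        (\<exists>k\<ge>1. \<exists>\<rho> Wp Wm. gauging_data (chart_range c) (E c) k \<rho> Wp Wm))"

end

theory Submission
  imports Defs
begin

text \<open>
  All \<open>n\<close> coordinate directions are gauged at once. In any chart take \<open>k = n\<close> and the coordinate
  fields \<open>\<rho>\<^sub>a = \<partial>\<^sub>a\<close>. They commute, so \<open>C = 0\<close>, and since
  \<open>E \<rho>\<close> is a square invertible matrix, \<open>E \<rho> (E \<rho>)\<^sup>+\<close> is the identity:
  the condition on \<open>\<Psi>\<^sub>a\<close> is void and \<open>det (\<rho>\<^sup>T E \<rho>) = det E\<close> does not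
  vanish (\<open>Psi_condition_frame\<close>).

  The generalised Killing equation becomes
  \<open>\<partial>\<^sub>a E = E W\<^sup>+\<^sub>a + (E\<^sup>T W\<^sup>-\<^sub>a)\<^sup>T\<close>, where \<open>W\<^sup>\<plusminus>\<^sub>a\<close> are the
  connection matrices of the adjoint connections: it says that \<open>E\<close> is covariantly constant when
  \<open>W\<^sup>-\<close> acts on its first slot and \<open>W\<^sup>+\<close> on its second. It is solved by
  \<open>W\<^sup>- = 0\<close> and \<open>W\<^sup>+\<^sub>a = E\<^sup>-\<^sup>1 \<partial>\<^sub>a E\<close>
  (\<open>generalised_killing_pure_gauge\<close>).

  Both are pure gauge, of the form \<open>F\<^sup>-\<^sup>1 \<partial>\<^sub>a F\<close> with \<open>F = 1\<close> and
  \<open>F = E\<close>. For such coefficients the adjoint connection is \<open>q, r \<mapsto> F\<^sup>-\<^sup>1 q(F r)\<close>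
  (\<open>adjoint_conn_pure_gauge\<close>), that is, the derivative along \<open>q\<close> conjugated by \<open>F\<close>, so its
  curvature vanishes because \<open>[q\<^sub>1, q\<^sub>2]\<close> is the commutator of derivations
  (\<open>flat_pure_gauge\<close>). The analytic inputs are the symmetry of second derivatives and the
  smoothness of \<open>F\<^sup>-\<^sup>1\<close>, which Cramer's rule gives.
\<close>

section \<open>Calculus of smooth maps\<close>

lemma frechet_derivative_eq:
  "(f has_derivative f') (at x) \<Longrightarrow> frechet_derivative f (at x) v = f' v"
  by (simp add: frechet_derivative_at[symmetric])

lemma Ck_on_cong:
  assumes "open S"
  shows "Ck_on m f S \<Longrightarrow> (\<And>x. x \<in> S \<Longrightarrow> f x = g x) \<Longrightarrow> Ck_on m g S"
proof (induction m arbitrary: f g)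
  case 0
  then show ?case using continuous_on_cong[OF refl, of S f g] by simp
next
  case (Suc m)
  have der: "(g has_derivative frechet_derivative f (at x)) (at x)" if "x \<in> S" for x
  proof (rule has_derivative_transform_within_open[OF _ assms that Suc.prems(2)])
    show "(f has_derivative frechet_derivative f (at x)) (at x)"
      using Suc.prems(1) that by (simp flip: frechet_derivative_works)
  qed
  have "Ck_on m (\<lambda>x. frechet_derivative g (at x) v) S" for v
  proof (rule Suc.IH)
    show "Ck_on m (\<lambda>x. frechet_derivative f (at x) v) S" using Suc.prems(1) by simp
  qed (simp add: frechet_derivative_eq[OF der])
  then show ?case using der by (auto simp: differentiable_def)
qed

lemma Ck_on_SucI:
  assumes "open S"
    and der: "\<And>x. x \<in> S \<Longrightarrow> (f has_derivative f' x) (at x)"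
    and Ck: "\<And>v. Ck_on m (\<lambda>x. f' x v) S"
  shows "Ck_on (Suc m) f S"
proof -
  have "Ck_on m (\<lambda>x. frechet_derivative f (at x) v) S" for v
    by (rule Ck_on_cong[OF assms(1) Ck[of v]]) (simp add: frechet_derivative_eq[OF der])
  then show ?thesis using der by (auto simp: differentiable_def)
qed

lemma Ck_on_has_derivative:
  "Ck_on (Suc m) f S \<Longrightarrow> x \<in> S \<Longrightarrow> (f has_derivative frechet_derivative f (at x)) (at x)"
  by (simp add: frechet_derivative_works[symmetric])

lemma Ck_on_SucD: "Ck_on (Suc m) f S \<Longrightarrow> Ck_on m f S"
proof (induction m arbitrary: f)
  case 0
  then show ?case
    by (auto intro!: continuous_at_imp_continuous_on differentiable_imp_continuous_within)
next
  case (Suc m)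
  then show ?case by (metis Ck_on.simps(2))
qed

lemma Ck_on_const: "Ck_on m (\<lambda>x. c) S"
  by (induction m arbitrary: c) auto

lemma Ck_on_add:
  assumes "open S"
  shows "Ck_on m f S \<Longrightarrow> Ck_on m g S \<Longrightarrow> Ck_on m (\<lambda>x. f x + g x) S"
proof (induction m arbitrary: f g)
  case 0
  then show ?case by (simp add: continuous_on_add)
next
  case (Suc m)
  show ?case
  proof (rule Ck_on_SucI[OF assms])
    show "((\<lambda>x. f x + g x) has_derivative
        (\<lambda>v. frechet_derivative f (at x) v + frechet_derivative g (at x) v)) (at x)" if "x \<in> S" for x
      by (intro has_derivative_add Suc.prems[THEN Ck_on_has_derivative] that)
    show "Ck_on m (\<lambda>x. frechet_derivative f (at x) v + frechet_derivative g (at x) v) S" for v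
      using Suc.prems by (intro Suc.IH) auto
  qed
qed

text \<open>The product rule expresses the derivative of a product by products of maps that are one degree
  less regular, so the induction must run over all pairs of factors. Arbitrary bilinear maps cover
  real products, scaling and the action of matrices on vectors together.\<close>

lemma (in bounded_bilinear) Ck_on_prod:
  assumes "open S"
  shows "Ck_on m f S \<Longrightarrow> Ck_on m g S \<Longrightarrow> Ck_on m (\<lambda>x. prod (f x) (g x)) S"
proof (induction m arbitrary: f g)
  case 0
  then show ?case by (simp add: continuous_on)
next
  case (Suc m)
  show ?case
  proof (rule Ck_on_SucI[OF assms])
    show "((\<lambda>x. prod (f x) (g x)) has_derivative
        (\<lambda>v. prod (f x) (frechet_derivative g (at x) v) + prod (frechet_derivative f (at x) v) (g x)))
          (at x)" if "x \<in> S" for x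
      by (intro FDERIV Suc.prems[THEN Ck_on_has_derivative] that)
    show "Ck_on m (\<lambda>x. prod (f x) (frechet_derivative g (at x) v) +
        prod (frechet_derivative f (at x) v) (g x)) S" for v
      using Suc.prems by (intro Ck_on_add assms Suc.IH Suc.prems[THEN Ck_on_SucD]) auto
  qed
qed

lemma Ck_on_inverse:
  fixes f :: "'a::real_normed_vector \<Rightarrow> real"
  assumes "open S" and nz: "\<And>x. x \<in> S \<Longrightarrow> f x \<noteq> 0"
  shows "Ck_on m f S \<Longrightarrow> Ck_on m (\<lambda>x. inverse (f x)) S"
proof (induction m)
  case 0
  then show ?case using nz by (auto intro!: continuous_on_inverse)
next
  case (Suc m)
  show ?case
  proof (rule Ck_on_SucI[OF assms(1)])
    show "((\<lambda>x. inverse (f x)) has_derivative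
        (\<lambda>v. - 1 * (inverse (f x) * (frechet_derivative f (at x) v * inverse (f x))))) (at x)"
      if "x \<in> S" for x
      using Deriv.has_derivative_inverse[OF nz[OF that] Ck_on_has_derivative[OF Suc.prems that]]
      by (simp add: mult.assoc)
    show "Ck_on m (\<lambda>x. - 1 * (inverse (f x) *
        (frechet_derivative f (at x) v * inverse (f x)))) S" for v
      using Suc.prems Suc.IH[OF Ck_on_SucD]
      by (intro bounded_bilinear.Ck_on_prod[OF bounded_bilinear_mult assms(1)] Ck_on_const) auto
  qed
qed

lemma smooth_on_cong:
  "open S \<Longrightarrow> smooth_on S f \<Longrightarrow> (\<And>x. x \<in> S \<Longrightarrow> f x = g x) \<Longrightarrow> smooth_on S g"
  unfolding smooth_on_def using Ck_on_cong by blast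

lemma smooth_on_const: "smooth_on S (\<lambda>x. c)"
  unfolding smooth_on_def using Ck_on_const by blast

lemma smooth_on_add:
  "open S \<Longrightarrow> smooth_on S f \<Longrightarrow> smooth_on S g \<Longrightarrow> smooth_on S (\<lambda>x. f x + g x)"
  unfolding smooth_on_def using Ck_on_add by blast

lemma (in bounded_bilinear) smooth_on_prod:
  "open S \<Longrightarrow> smooth_on S f \<Longrightarrow> smooth_on S g \<Longrightarrow> smooth_on S (\<lambda>x. prod (f x) (g x))"
  unfolding smooth_on_def using Ck_on_prod by blast

lemmas smooth_on_mult = bounded_bilinear.smooth_on_prod[OF bounded_bilinear_mult]
lemmas smooth_on_scaleR = bounded_bilinear.smooth_on_prod[OF bounded_bilinear_scaleR]

lemma smooth_on_bounded_linear:
  assumes "bounded_linear L" "open S" "smooth_on S f"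
  shows "smooth_on S (\<lambda>x. L (f x))"
proof -
  have "bounded_bilinear (\<lambda>(t::real) x. t *\<^sub>R L x)"
    using bounded_bilinear.comp[OF bounded_bilinear_scaleR bounded_linear_ident assms(1)] .
  from bounded_bilinear.smooth_on_prod[OF this assms(2) smooth_on_const assms(3), of 1]
  show ?thesis by simp
qed

lemma smooth_on_inverse:
  fixes f :: "'a::real_normed_vector \<Rightarrow> real"
  shows "open S \<Longrightarrow> (\<And>x. x \<in> S \<Longrightarrow> f x \<noteq> 0) \<Longrightarrow> smooth_on S f \<Longrightarrow>
    smooth_on S (\<lambda>x. inverse (f x))"
  unfolding smooth_on_def using Ck_on_inverse by blast

lemma smooth_on_sum:
  "open S \<Longrightarrow> (\<And>i. i \<in> I \<Longrightarrow> smooth_on S (f i)) \<Longrightarrow> smooth_on S (\<lambda>x. \<Sum>i\<in>I. f i x)"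
  by (induction I rule: infinite_finite_induct) (auto intro: smooth_on_const smooth_on_add)

lemma smooth_on_prod:
  fixes f :: "'i \<Rightarrow> 'a::real_normed_vector \<Rightarrow> real"
  shows "open S \<Longrightarrow> (\<And>i. i \<in> I \<Longrightarrow> smooth_on S (f i)) \<Longrightarrow> smooth_on S (\<lambda>x. \<Prod>i\<in>I. f i x)"
  by (induction I rule: infinite_finite_induct) (auto intro: smooth_on_const smooth_on_mult)

lemma smooth_on_frechet_derivative:
  "smooth_on S f \<Longrightarrow> smooth_on S (\<lambda>x. frechet_derivative f (at x) v)"
  unfolding smooth_on_def by (metis Ck_on.simps(2))

lemma smooth_on_partial: "smooth_on S f \<Longrightarrow> smooth_on S (partial \<mu> f)"
  unfolding partial_def[abs_def] by (rule smooth_on_frechet_derivative)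

lemma smooth_on_has_derivative:
  "smooth_on S f \<Longrightarrow> x \<in> S \<Longrightarrow> (f has_derivative frechet_derivative f (at x)) (at x)"
  unfolding smooth_on_def using Ck_on_has_derivative by blast

lemma smooth_on_nth: "open S \<Longrightarrow> smooth_on S f \<Longrightarrow> smooth_on S (\<lambda>x. f x $ i)"
  by (rule smooth_on_bounded_linear[OF bounded_linear_vec_nth])

lemma smooth_on_vec:
  fixes f :: "'a::real_normed_vector \<Rightarrow> real^'n"
  assumes "open S" "\<And>i. smooth_on S (\<lambda>x. f x $ i)"
  shows "smooth_on S f"
proof -
  have "smooth_on S (\<lambda>x. \<Sum>i\<in>UNIV. (f x $ i) *\<^sub>R axis i (1::real))"
    by (intro smooth_on_sum smooth_on_scaleR assms smooth_on_const)
  then show ?thesis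
    using basis_expansion[of "f _"] by (simp add: scalar_mult_eq_scaleR)
qed

lemma smooth_on_det:
  fixes f :: "'a::real_normed_vector \<Rightarrow> real^'n^'n"
  assumes "open S" "\<And>i j. smooth_on S (\<lambda>x. f x $ i $ j)"
  shows "smooth_on S (\<lambda>x. Determinants.det (f x))"
  unfolding Determinants.det_def
  by (intro smooth_on_sum smooth_on_mult smooth_on_prod smooth_on_const assms)

lemma matrix_inv_right: "invertible A \<Longrightarrow> A ** matrix_inv A = mat 1"
  and matrix_inv_left: "invertible A \<Longrightarrow> matrix_inv A ** A = mat 1"
  unfolding matrix_inv_def invertible_def by (metis (mono_tags, lifting) someI_ex)+

text \<open>By Cramer's rule the entries of the inverse are quotients of determinants, hence rational
  functions of the entries of the matrix.\<close>

lemma smooth_on_matrix_inv: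
  fixes F :: "'a::real_normed_vector \<Rightarrow> real^'n^'n"
  assumes "open S" "smooth_on S F" and inv: "\<And>x. x \<in> S \<Longrightarrow> invertible (F x)"
  shows "smooth_on S (\<lambda>x. matrix_inv (F x) $ i $ j)"
proof -
  let ?N = "\<lambda>x. \<chi> k l. if l = i then axis j 1 $ k else F x $ k $ l"
  have comp: "smooth_on S (\<lambda>x. F x $ k $ l)" for k l
    by (intro smooth_on_nth assms)
  have nz: "Determinants.det (F x) \<noteq> 0" if "x \<in> S" for x
    using inv[OF that] invertible_det_nz by blast
  have cramer': "Determinants.det (?N x) * inverse (Determinants.det (F x)) = matrix_inv (F x) $ i $ j"
    if "x \<in> S" for x
  proof -
    have "F x *v (matrix_inv (F x) *v axis j 1) = axis j 1"
      using matrix_inv_right[OF inv[OF that]] by (simp add: matrix_vector_mul_assoc)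
    then have "matrix_inv (F x) *v axis j 1 =
        (\<chi> m. Determinants.det (\<chi> k l. if l = m then axis j 1 $ k else F x $ k $ l) /
          Determinants.det (F x))"
      using cramer[OF nz[OF that]] by blast
    from arg_cong[OF this, of "\<lambda>v. v $ i"] show ?thesis
      by (simp add: matrix_vector_mult_basis column_def divide_inverse)
  qed
  have "smooth_on S (\<lambda>x. ?N x $ k $ l)" for k l
    by (cases "l = i") (simp_all add: smooth_on_const comp)
  then have "smooth_on S (\<lambda>x. Determinants.det (?N x) * inverse (Determinants.det (F x)))"
    by (intro smooth_on_mult smooth_on_inverse smooth_on_det assms(1) nz comp)
  then show ?thesis
    by (rule smooth_on_cong[OF assms(1)]) (rule cramer')
qed

section \<open>Symmetry of second derivatives\<close>

text \<open>Two applications of the mean value theorem, first in direction \<open>v\<close>, then in direction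
  \<open>w\<close>. The left-hand side is symmetric in \<open>v\<close> and \<open>w\<close>, the second derivative on the
  right is not visibly so: comparing the two orders as \<open>t \<rightarrow> 0\<close> yields the symmetry.\<close>

lemma second_difference_mvt:
  fixes f :: "'a::real_normed_vector \<Rightarrow> real"
  assumes Ck: "Ck_on 2 f S" and t: "0 < t"
    and sub: "\<And>r s. 0 \<le> r \<Longrightarrow> r \<le> t \<Longrightarrow> 0 \<le> s \<Longrightarrow> s \<le> t \<Longrightarrow> x + r *\<^sub>R v + s *\<^sub>R w \<in> S"
  shows "\<exists>r s. 0 \<le> r \<and> r \<le> t \<and> 0 \<le> s \<and> s \<le> t \<and>
    f (x + t *\<^sub>R v + t *\<^sub>R w) - f (x + t *\<^sub>R v) - f (x + t *\<^sub>R w) + f x =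
    t * t * frechet_derivative (\<lambda>z. frechet_derivative f (at z) v) (at (x + r *\<^sub>R v + s *\<^sub>R w)) w"
proof -
  let ?D = "\<lambda>z. frechet_derivative f (at z)"
  have f: "(f has_derivative ?D z) (at z)" if "z \<in> S" for z
    using Ck that Ck_on_has_derivative by (metis numeral_2_eq_2)
  have Df: "((\<lambda>z. ?D z v) has_derivative frechet_derivative (\<lambda>z. ?D z v) (at z)) (at z)" if "z \<in> S" for z
    using Ck that by (intro Ck_on_has_derivative[of 0 _ S]) (simp_all add: numeral_2_eq_2)
  have chain: "((\<lambda>r. g (a r)) has_real_derivative g' d) (at r)"
    if g: "(g has_derivative g') (at (a r))" and a: "(a has_derivative (\<lambda>h. h *\<^sub>R d)) (at r)"
    for g :: "'a \<Rightarrow> real" and g' a r d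
  proof -
    have "linear g'" using g has_derivative_linear by blast
    then show ?thesis
      using has_derivative_compose[OF a g]
      by (simp add: has_field_derivative_def linear_cmul mult_commute_abs)
  qed
  have line: "((\<lambda>r. p + r *\<^sub>R u + q) has_derivative (\<lambda>h. h *\<^sub>R u)) (at r)" for p q u :: 'a and r :: real
    by (auto intro!: derivative_eq_intros)
  \<comment> \<open>The summand \<open>0 *\<^sub>R w\<close> puts both terms in the form handled by \<open>line\<close>.\<close>
  define g where "g r = f (x + r *\<^sub>R v + t *\<^sub>R w) - f (x + r *\<^sub>R v + 0 *\<^sub>R w)" for r
  define g' where "g' r = ?D (x + r *\<^sub>R v + t *\<^sub>R w) v - ?D (x + r *\<^sub>R v + 0 *\<^sub>R w) v" for r
  have "(g has_real_derivative g' r) (at r)" if "0 \<le> r" "r \<le> t" for r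
    unfolding g_def[abs_def] g'_def
    by (rule DERIV_diff; rule chain[of f, OF _ line], rule f, rule sub) (use that t in auto)
  then obtain r where r: "0 < r" "r < t" "g t - g 0 = t * g' r"
    using MVT2[OF t, of g g'] by auto
  have "((\<lambda>s. ?D (x + r *\<^sub>R v + s *\<^sub>R w) v) has_real_derivative
      frechet_derivative (\<lambda>z. ?D z v) (at (x + r *\<^sub>R v + s *\<^sub>R w)) w) (at s)" if "0 \<le> s" "s \<le> t" for s
    by (rule chain[of "\<lambda>z. ?D z v" _ "\<lambda>s. x + r *\<^sub>R v + s *\<^sub>R w", OF Df])
      (use r that sub line[of "x + r *\<^sub>R v" w 0] in auto)
  then obtain s where s: "0 < s" "s < t"
      "g' r = t * frechet_derivative (\<lambda>z. ?D z v) (at (x + r *\<^sub>R v + s *\<^sub>R w)) w"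
    using MVT2[OF t, of "\<lambda>s. ?D (x + r *\<^sub>R v + s *\<^sub>R w) v"
      "\<lambda>s. frechet_derivative (\<lambda>z. ?D z v) (at (x + r *\<^sub>R v + s *\<^sub>R w)) w"]
    by (auto simp: g'_def)
  have "f (x + t *\<^sub>R v + t *\<^sub>R w) - f (x + t *\<^sub>R v) - f (x + t *\<^sub>R w) + f x = g t - g 0"
    by (simp add: g_def)
  also have "\<dots> = t * t * frechet_derivative (\<lambda>z. ?D z v) (at (x + r *\<^sub>R v + s *\<^sub>R w)) w"
    using r s by simp
  finally show ?thesis using r s by (intro exI[of _ r] exI[of _ s]) auto
qed

lemma second_derivative_symmetric_real:
  fixes f :: "'a::real_normed_vector \<Rightarrow> real"
  assumes "open S" "Ck_on 2 f S" "x \<in> S"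
  shows "frechet_derivative (\<lambda>z. frechet_derivative f (at z) v) (at x) w =
    frechet_derivative (\<lambda>z. frechet_derivative f (at z) w) (at x) v"
proof -
  define D2 where "D2 v w z = frechet_derivative (\<lambda>z. frechet_derivative f (at z) v) (at z) w" for v w z
  have cont: "isCont (D2 v w) x" for v w
    using assms by (simp add: numeral_2_eq_2 D2_def[abs_def] continuous_on_eq_continuous_at)
  have near: "\<exists>t>0. \<forall>r s. 0 \<le> r \<and> r \<le> t \<and> 0 \<le> s \<and> s \<le> t \<longrightarrow> P (x + r *\<^sub>R v + s *\<^sub>R w)"
    if P: "eventually P (nhds x)" for P
  proof -
    obtain d where d: "d > 0" "\<And>y. dist y x < d \<Longrightarrow> P y"
      using P by (auto simp: eventually_nhds_metric)
    \<comment> \<open>The summand 1 keeps the denominator positive when \<open>v = w = 0\<close>.\<close>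
    define t where "t = d / (2 * (norm v + norm w + 1))"
    have pos: "norm v + norm w + 1 > 0" by (smt (verit) norm_ge_zero)
    have "P (x + r *\<^sub>R v + s *\<^sub>R w)" if "0 \<le> r" "r \<le> t" "0 \<le> s" "s \<le> t" for r s
    proof (rule d(2))
      have "dist (x + r *\<^sub>R v + s *\<^sub>R w) x \<le> r * norm v + s * norm w"
        using that norm_triangle_ineq[of "r *\<^sub>R v" "s *\<^sub>R w"] by (simp add: dist_norm add.assoc)
      also have "\<dots> \<le> t * norm v + t * norm w"
        using that by (intro add_mono mult_right_mono) auto
      also have "\<dots> \<le> t * (norm v + norm w + 1)"
        using that by (simp add: algebra_simps)
      also have "\<dots> = d / 2" using pos by (simp add: t_def field_simps)
      also have "\<dots> < d" using d by simp
      finally show "dist (x + r *\<^sub>R v + s *\<^sub>R w) x < d" .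
    qed
    moreover have "t > 0" using d pos by (simp add: t_def)
    ultimately show ?thesis by blast
  qed
  have "\<bar>D2 v w x - D2 w v x\<bar> \<le> e" if "e > 0" for e
  proof -
    have "eventually (\<lambda>y. y \<in> S \<and> dist (D2 v w y) (D2 v w x) < e / 2 \<and>
        dist (D2 w v y) (D2 w v x) < e / 2) (nhds x)"
      using assms(1,3) that
      by (intro eventually_conj eventually_nhds_in_open tendstoD
          cont[unfolded continuous_at tendsto_at_iff_tendsto_nhds]) auto
    from near[OF this] obtain t where t: "t > 0"
      and box: "\<And>r s. 0 \<le> r \<Longrightarrow> r \<le> t \<Longrightarrow> 0 \<le> s \<Longrightarrow> s \<le> t \<Longrightarrow>
        x + r *\<^sub>R v + s *\<^sub>R w \<in> S \<and> dist (D2 v w (x + r *\<^sub>R v + s *\<^sub>R w)) (D2 v w x) < e / 2 \<and>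
        dist (D2 w v (x + r *\<^sub>R v + s *\<^sub>R w)) (D2 w v x) < e / 2"
      by blast
    define \<Delta> where "\<Delta> = f (x + t *\<^sub>R v + t *\<^sub>R w) - f (x + t *\<^sub>R v) - f (x + t *\<^sub>R w) + f x"
    obtain r s where 1: "0 \<le> r" "r \<le> t" "0 \<le> s" "s \<le> t"
        "\<Delta> = t * t * D2 v w (x + r *\<^sub>R v + s *\<^sub>R w)"
      using second_difference_mvt[OF assms(2) t, of x v w] box by (auto simp: D2_def \<Delta>_def)
    have swap: "x + a *\<^sub>R w + b *\<^sub>R v = x + b *\<^sub>R v + a *\<^sub>R w" for a b
      by (simp add: add_ac)
    obtain r' s' where 2: "0 \<le> r'" "r' \<le> t" "0 \<le> s'" "s' \<le> t"
        and "f (x + t *\<^sub>R v + t *\<^sub>R w) - f (x + t *\<^sub>R w) - f (x + t *\<^sub>R v) + f x =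
          t * t * D2 w v (x + r' *\<^sub>R v + s' *\<^sub>R w)"
      using second_difference_mvt[OF assms(2) t, of x w v, unfolded swap] box unfolding D2_def by blast
    then have \<Delta>2: "\<Delta> = t * t * D2 w v (x + r' *\<^sub>R v + s' *\<^sub>R w)"
      by (simp add: \<Delta>_def)
    have "D2 v w (x + r *\<^sub>R v + s *\<^sub>R w) = D2 w v (x + r' *\<^sub>R v + s' *\<^sub>R w)"
      using 1(5) \<Delta>2 t by simp
    then show ?thesis
      using box[OF 1(1-4), THEN conjunct2, THEN conjunct1] box[OF 2, THEN conjunct2, THEN conjunct2]
      unfolding dist_real_def by linarith
  qed
  then have "\<bar>D2 v w x - D2 w v x\<bar> \<le> 0"
    by (rule field_le_epsilon) simp
  then have "D2 v w x = D2 w v x" by simp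
  then show ?thesis by (simp add: D2_def)
qed

lemma second_derivative_symmetric:
  fixes f :: "'a::real_normed_vector \<Rightarrow> real^'n"
  assumes "open S" "smooth_on S f" "x \<in> S"
  shows "frechet_derivative (\<lambda>z. frechet_derivative f (at z) v) (at x) w =
    frechet_derivative (\<lambda>z. frechet_derivative f (at z) w) (at x) v"
proof -
  have nth: "frechet_derivative (\<lambda>z. g z $ i) (at y) u = frechet_derivative g (at y) u $ i"
    if "smooth_on S g" "y \<in> S" for g :: "'a \<Rightarrow> real^'n" and i y u
    using bounded_linear.has_derivative[OF bounded_linear_vec_nth smooth_on_has_derivative[OF that]]
    by (rule frechet_derivative_eq)
  have nth2: "frechet_derivative (\<lambda>z. frechet_derivative f (at z) v) (at x) w $ i =
      frechet_derivative (\<lambda>z. frechet_derivative (\<lambda>z. f z $ i) (at z) v) (at x) w" for v w i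
  proof -
    have Df: "smooth_on S (\<lambda>z. frechet_derivative f (at z) v)"
      by (rule smooth_on_frechet_derivative[OF assms(2)])
    have "((\<lambda>z. frechet_derivative f (at z) v $ i) has_derivative
        (\<lambda>u. frechet_derivative (\<lambda>z. frechet_derivative f (at z) v) (at x) u $ i)) (at x)"
      by (rule bounded_linear.has_derivative[OF bounded_linear_vec_nth
            smooth_on_has_derivative[OF Df assms(3)]])
    then have "((\<lambda>z. frechet_derivative (\<lambda>z. f z $ i) (at z) v) has_derivative
        (\<lambda>u. frechet_derivative (\<lambda>z. frechet_derivative f (at z) v) (at x) u $ i)) (at x)"
      using assms(1,3)
      by (rule has_derivative_transform_within_open) (simp add: nth[OF assms(2)])
    then show ?thesis by (rule frechet_derivative_eq[symmetric])
  qed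
  have "Ck_on 2 (\<lambda>z. f z $ i) S" for i
    using smooth_on_nth[OF assms(1,2)] by (simp add: smooth_on_def)
  then show ?thesis
    unfolding vec_eq_iff nth2 using second_derivative_symmetric_real[OF assms(1) _ assms(3)] by blast
qed

lemma partial_const: "partial \<mu> (\<lambda>x. c) x = 0"
  by (simp add: partial_def)

lemma has_derivative_sum_partial:
  assumes "(g has_derivative g') (at x)"
  shows "(\<Sum>\<mu>\<in>UNIV. u $ \<mu> *\<^sub>R partial \<mu> g x) = g' u"
proof -
  have lin: "linear g'" using assms has_derivative_linear by blast
  have "(\<Sum>\<mu>\<in>UNIV. u $ \<mu> *\<^sub>R partial \<mu> g x) = (\<Sum>\<mu>\<in>UNIV. g' (u $ \<mu> *\<^sub>R axis \<mu> 1))"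
    by (simp add: partial_def frechet_derivative_eq[OF assms] linear_scale[OF lin])
  also have "\<dots> = g' (\<Sum>\<mu>\<in>UNIV. u $ \<mu> *\<^sub>R axis \<mu> 1)"
    by (rule linear_sum[OF lin, symmetric])
  finally show ?thesis
    using basis_expansion[of u] by (simp add: scalar_mult_eq_scaleR)
qed

lemma smooth_on_directional_derivative:
  fixes f :: "real^'n::finite \<Rightarrow> 'b::real_normed_vector"
  assumes "open S" "smooth_on S f" "smooth_on S V"
  shows "smooth_on S (\<lambda>x. frechet_derivative f (at x) (V x))"
proof (rule smooth_on_cong[OF assms(1)])
  show "smooth_on S (\<lambda>x. \<Sum>\<mu>\<in>UNIV. V x $ \<mu> *\<^sub>R partial \<mu> f x)"
    by (rule smooth_on_sum[OF assms(1)], rule smooth_on_scaleR[OF assms(1)],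
        rule smooth_on_nth[OF assms(1,3)], rule smooth_on_partial[OF assms(2)])
  show "(\<Sum>\<mu>\<in>UNIV. V x $ \<mu> *\<^sub>R partial \<mu> f x) = frechet_derivative f (at x) (V x)" if "x \<in> S" for x
    by (rule has_derivative_sum_partial[OF smooth_on_has_derivative[OF assms(2) that]])
qed

lemma has_derivative_directional_derivative:
  fixes f :: "real^'n::finite \<Rightarrow> 'b::real_normed_vector"
  assumes "open S" "smooth_on S f" "smooth_on S V" "x \<in> S"
  shows "((\<lambda>y. frechet_derivative f (at y) (V y)) has_derivative
    (\<lambda>u. frechet_derivative (\<lambda>y. frechet_derivative f (at y) (V x)) (at x) u +
      frechet_derivative f (at x) (frechet_derivative V (at x) u))) (at x)"
proof -
  note D = smooth_on_has_derivative
  \<comment> \<open>In terms of partial derivatives, the derivative along \<open>V\<close> is a sum of products, to which the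
    product rule applies.\<close>
  have df: "frechet_derivative f (at y) v = (\<Sum>\<mu>\<in>UNIV. v $ \<mu> *\<^sub>R partial \<mu> f y)" if "y \<in> S" for y v
    by (rule has_derivative_sum_partial[OF D[OF assms(2) that], symmetric])
  have part: "(partial \<mu> f has_derivative frechet_derivative (partial \<mu> f) (at x)) (at x)" for \<mu>
    by (rule D[OF smooth_on_partial[OF assms(2)] assms(4)])
  have nth: "((\<lambda>y. V y $ \<mu>) has_derivative (\<lambda>u. frechet_derivative V (at x) u $ \<mu>)) (at x)" for \<mu>
    by (rule bounded_linear.has_derivative[OF bounded_linear_vec_nth D[OF assms(3,4)]])
  have const: "frechet_derivative (\<lambda>y. frechet_derivative f (at y) v) (at x) u =
      (\<Sum>\<mu>\<in>UNIV. v $ \<mu> *\<^sub>R frechet_derivative (partial \<mu> f) (at x) u)" for v u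
  proof (rule frechet_derivative_eq)
    have "((\<lambda>y. \<Sum>\<mu>\<in>UNIV. v $ \<mu> *\<^sub>R partial \<mu> f y) has_derivative
        (\<lambda>u. \<Sum>\<mu>\<in>UNIV. v $ \<mu> *\<^sub>R frechet_derivative (partial \<mu> f) (at x) u)) (at x)"
      by (intro has_derivative_sum has_derivative_scaleR_right part)
    then show "((\<lambda>y. frechet_derivative f (at y) v) has_derivative
        (\<lambda>u. \<Sum>\<mu>\<in>UNIV. v $ \<mu> *\<^sub>R frechet_derivative (partial \<mu> f) (at x) u)) (at x)"
      by (rule has_derivative_transform_within_open[OF _ assms(1,4)]) (simp add: df)
  qed
  have "((\<lambda>y. \<Sum>\<mu>\<in>UNIV. V y $ \<mu> *\<^sub>R partial \<mu> f y) has_derivative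
      (\<lambda>u. \<Sum>\<mu>\<in>UNIV. V x $ \<mu> *\<^sub>R frechet_derivative (partial \<mu> f) (at x) u +
        frechet_derivative V (at x) u $ \<mu> *\<^sub>R partial \<mu> f x)) (at x)"
    by (rule has_derivative_sum, rule has_derivative_scaleR[OF nth part])
  then have "((\<lambda>y. frechet_derivative f (at y) (V y)) has_derivative
      (\<lambda>u. \<Sum>\<mu>\<in>UNIV. V x $ \<mu> *\<^sub>R frechet_derivative (partial \<mu> f) (at x) u +
        frechet_derivative V (at x) u $ \<mu> *\<^sub>R partial \<mu> f x)) (at x)"
    by (rule has_derivative_transform_within_open[OF _ assms(1,4)]) (simp add: df)
  then show ?thesis
    by (simp add: const df[OF assms(4)] sum.distrib)
qed

text \<open>The second-order terms cancel by symmetry of the second derivative; only the derivatives of the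
  direction fields survive. This is the source of flatness.\<close>

lemma commutator_directional_derivatives:
  fixes f :: "real^'n::finite \<Rightarrow> real^'m"
  assumes "open S" "smooth_on S f" "smooth_on S V" "smooth_on S W" "x \<in> S"
  shows "frechet_derivative (\<lambda>y. frechet_derivative f (at y) (W y)) (at x) (V x) -
      frechet_derivative (\<lambda>y. frechet_derivative f (at y) (V y)) (at x) (W x) =
    frechet_derivative f (at x) (frechet_derivative W (at x) (V x) - frechet_derivative V (at x) (W x))"
proof -
  have lin: "linear (frechet_derivative f (at x))"
    using smooth_on_has_derivative[OF assms(2,5)] has_derivative_linear by blast
  note D = frechet_derivative_eq[OF has_derivative_directional_derivative[OF assms(1,2) _ assms(5)]]
  show ?thesis
    unfolding D[OF assms(3)] D[OF assms(4)]
    using second_derivative_symmetric[OF assms(1,2,5), of "V x" "W x"]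
    by (simp add: linear_diff[OF lin])
qed


section \<open>The coordinate frame\<close>

text \<open>The frame index of the gauging data is a natural number while the coordinate index lives in
  the type \<open>'n\<close>; the bijection \<open>h\<close> translates between the two.\<close>

locale coordinate_frame =
  fixes h :: "nat \<Rightarrow> 'n::finite"
  assumes bij: "bij_betw h {..<CARD('n)} UNIV"
begin

definition frame :: "nat \<Rightarrow> real^'n \<Rightarrow> real^'n" where
  "frame a x = axis (h a) 1"

lemma inj_h: "a < CARD('n) \<Longrightarrow> b < CARD('n) \<Longrightarrow> h a = h b \<longleftrightarrow> a = b"
  using bij by (auto simp: bij_betw_def inj_on_def)

lemma sum_h: "(\<Sum>a<CARD('n). f (h a)) = (\<Sum>i\<in>UNIV. f i)"
  by (rule sum.reindex_bij_betw[OF bij])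

lemma linearly_independent_frame: "linearly_independent_at CARD('n) frame x"
proof -
  have "inj_on (\<lambda>a. frame a x) {..<CARD('n)}"
    by (rule inj_onI) (simp add: frame_def axis_eq_axis inj_h)
  moreover have "(\<lambda>a. frame a x) ` {..<CARD('n)} \<subseteq> Basis"
    by (auto simp: frame_def)
  ultimately show ?thesis
    unfolding linearly_independent_at_def using independent_mono[OF independent_Basis] by blast
qed

lemma smooth_frame: "smooth_on S (frame a)"
  unfolding frame_def[abs_def] by (rule smooth_on_const)

lemma involutive_frame: "involutive_on S CARD('n) frame (\<lambda>c a b x. 0)"
  by (simp add: involutive_on_def smooth_on_const lie_bracket_def frame_def[abs_def] partial_const)

lemma lie_derivative_frame:
  "lie_derivative2 (frame a) E x = partial (h a) E x"
proof -
  have "(\<Sum>\<sigma>\<in>UNIV. frame a x $ \<sigma> * partial \<sigma> E x $ \<mu> $ \<nu>) = partial (h a) E x $ \<mu> $ \<nu>" for \<mu> \<nu>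
    by (simp add: frame_def axis_def if_distrib[of "\<lambda>t. t * _"] cong: if_cong)
  then show ?thesis
    by (simp add: lie_derivative2_def vec_eq_iff frame_def[abs_def] partial_const)
qed

text \<open>The bridge from type-indexed matrices to matrices with explicit dimension, which
  \<open>gram\<close>, \<open>pinv\<close> and the nondegeneracy condition refer to. It is multiplicative, so
  inverses and nonvanishing of determinants carry over.\<close>

definition to_mat :: "real^'n^'n \<Rightarrow> real Matrix.mat" where
  "to_mat A = Matrix.mat CARD('n) CARD('n) (\<lambda>(a, b). A $ h a $ h b)"

lemma to_mat_carrier: "to_mat A \<in> carrier_mat CARD('n) CARD('n)"
  by (simp add: to_mat_def)

lemma to_mat_mult: "to_mat (A ** B) = to_mat A * to_mat B"
proof (rule eq_matI)
  fix a b assume "a < dim_row (to_mat A * to_mat B)" "b < dim_col (to_mat A * to_mat B)"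
  then have ab: "a < CARD('n)" "b < CARD('n)" by (simp_all add: to_mat_def)
  have "(\<Sum>c<CARD('n). A $ h a $ h c * B $ h c $ h b) = (\<Sum>i\<in>UNIV. A $ h a $ i * B $ i $ h b)"
    by (rule sum_h)
  then show "to_mat (A ** B) $$ (a, b) = (to_mat A * to_mat B) $$ (a, b)"
    using ab by (simp add: to_mat_def scalar_prod_def matrix_matrix_mult_def atLeast0LessThan)
qed (simp_all add: to_mat_def)

lemma to_mat_one: "to_mat (Finite_Cartesian_Product.mat 1) = 1\<^sub>m CARD('n)"
  by (rule eq_matI) (auto simp: to_mat_def Finite_Cartesian_Product.mat_def inj_h)

lemma det_to_mat:
  assumes "invertible A"
  shows "Determinant.det (to_mat A) \<noteq> 0"
proof -
  have "Determinant.det (to_mat A) * Determinant.det (to_mat (matrix_inv A)) = 1"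
    using det_mult[OF to_mat_carrier to_mat_carrier, of A "matrix_inv A"]
    by (simp add: to_mat_mult[symmetric] matrix_inv_right[OF assms] to_mat_one)
  then show ?thesis by auto
qed

lemma mat_inverse_to_mat:
  assumes "invertible A"
  shows "mat_inverse (to_mat A) = Some (to_mat (matrix_inv A))"
proof -
  let ?A = "to_mat A" and ?B = "to_mat (matrix_inv A)"
  have AB: "?A * ?B = 1\<^sub>m CARD('n)" "?B * ?A = 1\<^sub>m CARD('n)"
    by (simp_all add: to_mat_mult[symmetric] matrix_inv_right[OF assms] matrix_inv_left[OF assms] to_mat_one)
  then have "?A \<in> Units (ring_mat TYPE(real) CARD('n) ())"
    using to_mat_carrier by (auto simp: Units_def ring_mat_simps)
  then obtain C where C: "mat_inverse ?A = Some C"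
    using mat_inverse(1)[OF to_mat_carrier, where b = "()"] by (cases "mat_inverse ?A") auto
  then have CA: "C * ?A = 1\<^sub>m CARD('n)" and C': "C \<in> carrier_mat CARD('n) CARD('n)"
    using mat_inverse(2)[OF to_mat_carrier C] by simp_all
  have "C = C * (?A * ?B)"
    unfolding AB by (rule right_mult_one_mat[OF C', symmetric])
  also have "\<dots> = C * ?A * ?B"
    by (rule assoc_mult_mat[OF C' to_mat_carrier to_mat_carrier, symmetric])
  also have "\<dots> = ?B"
    unfolding CA by (rule left_mult_one_mat[OF to_mat_carrier])
  finally show ?thesis using C by simp
qed

text \<open>For an invertible \<open>U\<close> the left inverse \<open>U\<^sup>+ = (U\<^sup>T U)\<^sup>-\<^sup>1 U\<^sup>T\<close> is also a right
  inverse, so the projector \<open>U U\<^sup>+\<close> is the identity.\<close>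

lemma column_pinv:
  fixes U :: "real^'n^'n"
  assumes "invertible U"
  shows "(\<Sum>a<CARD('n). column (h a) U $ \<mu> * pinv CARD('n) (\<lambda>a. column (h a) U) a $ \<sigma>) = (if \<mu> = \<sigma> then 1 else 0)"
proof -
  let ?G = "transpose U ** U"
  let ?P = "matrix_inv ?G ** transpose U"
  have inv: "invertible ?G"
    by (intro invertible_mult transpose_invertible assms)
  have gram: "gram CARD('n) (\<lambda>a. column (h a) U) = to_mat ?G"
    by (rule eq_matI) (simp_all add: gram_def to_mat_def matrix_matrix_mult_def inner_vec_def
        column_def transpose_def)
  have U': "transpose U $ j $ \<sigma> = U $ \<sigma> $ j" for j
    by (simp add: transpose_def)
  have pinv: "pinv CARD('n) (\<lambda>a. column (h a) U) a $ \<sigma> = ?P $ h a $ \<sigma>" if "a < CARD('n)" for a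
  proof -
    have "pinv CARD('n) (\<lambda>a. column (h a) U) a $ \<sigma> =
        (\<Sum>b<CARD('n). matrix_inv ?G $ h a $ h b * transpose U $ h b $ \<sigma>)"
      unfolding pinv_def gram mat_inverse_to_mat[OF inv] option.sel
      using that by (simp add: to_mat_def column_def U')
    also have "\<dots> = ?P $ h a $ \<sigma>"
      unfolding matrix_matrix_mult_def[of "matrix_inv ?G"] vec_lambda_beta by (rule sum_h)
    finally show ?thesis .
  qed
  have "?P ** U = Finite_Cartesian_Product.mat 1"
    using matrix_inv_left[OF inv] by (simp add: matrix_mul_assoc)
  then have UP: "U ** ?P = Finite_Cartesian_Product.mat 1"
    using matrix_left_right_inverse by blast
  have "(\<Sum>a<CARD('n). column (h a) U $ \<mu> * pinv CARD('n) (\<lambda>a. column (h a) U) a $ \<sigma>) = (U ** ?P) $ \<mu> $ \<sigma>"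
  proof -
    have "(\<Sum>a<CARD('n). column (h a) U $ \<mu> * pinv CARD('n) (\<lambda>a. column (h a) U) a $ \<sigma>) =
        (\<Sum>a<CARD('n). U $ \<mu> $ h a * ?P $ h a $ \<sigma>)"
      by (rule sum.cong[OF refl], subst pinv) (simp_all add: column_def)
    also have "\<dots> = (U ** ?P) $ \<mu> $ \<sigma>"
      unfolding matrix_matrix_mult_def[of U] vec_lambda_beta by (rule sum_h)
    finally show ?thesis .
  qed
  then show ?thesis by (simp add: UP Finite_Cartesian_Product.mat_def)
qed

lemma Erho_frame: "Erho frame E x = (\<lambda>b. column (h b) (E x))"
  by (simp add: fun_eq_iff Erho_def frame_def matrix_vector_mult_basis)

lemma Psi_condition_frame:
  assumes "\<And>x. x \<in> S \<Longrightarrow> invertible (E x)"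
  shows "Psi_condition S CARD('n) frame C E"
  unfolding Psi_condition_def
proof (intro ballI conjI allI impI)
  fix x a \<mu> \<nu> assume x: "x \<in> S"
  have "(\<Sum>b<CARD('n). \<Sum>\<sigma>\<in>UNIV. Erho frame E x b $ \<mu> * pinv CARD('n) (Erho frame E x) b $ \<sigma> *
        Psi CARD('n) frame C E a x $ \<sigma> $ \<nu>) =
      (\<Sum>\<sigma>\<in>UNIV. (\<Sum>b<CARD('n). Erho frame E x b $ \<mu> * pinv CARD('n) (Erho frame E x) b $ \<sigma>) *
        Psi CARD('n) frame C E a x $ \<sigma> $ \<nu>)"
    by (subst sum.swap) (simp add: sum_distrib_right)
  then show "Psi CARD('n) frame C E a x $ \<mu> $ \<nu> =
      (\<Sum>b<CARD('n). \<Sum>\<sigma>\<in>UNIV. Erho frame E x b $ \<mu> * pinv CARD('n) (Erho frame E x) b $ \<sigma> *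
        Psi CARD('n) frame C E a x $ \<sigma> $ \<nu>)"
    by (simp add: Erho_frame column_pinv[OF assms[OF x]] if_distrib[of "\<lambda>t. t * _"] cong: if_cong)
next
  fix x assume x: "x \<in> S"
  have "Matrix.mat CARD('n) CARD('n) (\<lambda>(a, b). inner (frame a x) (Erho frame E x b)) = to_mat (E x)"
    by (rule eq_matI) (simp_all add: to_mat_def Erho_frame frame_def inner_axis' column_def)
  then show "Determinant.det (Matrix.mat CARD('n) CARD('n) (\<lambda>(a, b). inner (frame a x) (Erho frame E x b))) \<noteq> 0"
    using det_to_mat[OF assms[OF x]] by simp
qed


section \<open>Pure gauge connections\<close>

text \<open>In the coordinate frame the anchor is the identity: a section of the bundle and the vector
  field it is anchored to have the same components.\<close>

definition vec_of :: "'n sect \<Rightarrow> real^'n \<Rightarrow> real^'n" where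
  "vec_of q x = (\<chi> i. q (inv_into {..<CARD('n)} h i) x)"

lemma vec_of_nth: "a < CARD('n) \<Longrightarrow> vec_of q x $ h a = q a x"
  using bij by (simp add: vec_of_def bij_betw_inv_into_left)

lemma smooth_on_vec_of:
  assumes "open S" "smooth_section S CARD('n) q"
  shows "smooth_on S (vec_of q)"
proof (rule smooth_on_vec[OF assms(1)])
  fix i
  have "inv_into {..<CARD('n)} h i < CARD('n)"
    using bij inv_into_into[of i h "{..<CARD('n)}"] by (auto simp: bij_betw_def)
  then show "smooth_on S (\<lambda>x. vec_of q x $ i)"
    using assms(2) by (simp add: vec_of_def smooth_section_def)
qed

lemma anchor_frame: "anchor CARD('n) frame q x = vec_of q x"
proof -
  have "anchor CARD('n) frame q x = (\<Sum>a<CARD('n). vec_of q x $ h a *\<^sub>R axis (h a) 1)"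
    by (simp add: anchor_def frame_def vec_of_nth)
  also have "\<dots> = (\<Sum>i\<in>UNIV. vec_of q x $ i *\<^sub>R axis i 1)"
    by (rule sum_h)
  finally show ?thesis
    using basis_expansion[of "vec_of q x"] by (simp add: scalar_mult_eq_scaleR)
qed

lemma directional_derivative_section:
  assumes "(vec_of q has_derivative q') (at x)" "a < CARD('n)"
  shows "(\<Sum>\<mu>\<in>UNIV. u $ \<mu> * partial \<mu> (q a) x) = q' u $ h a"
proof -
  have "((\<lambda>y. vec_of q y $ h a) has_derivative (\<lambda>u. q' u $ h a)) (at x)"
    by (rule bounded_linear.has_derivative[OF bounded_linear_vec_nth assms(1)])
  then have "(q a has_derivative (\<lambda>u. q' u $ h a)) (at x)"
    using assms(2) by (simp add: vec_of_nth)
  from has_derivative_sum_partial[OF this, of u] show ?thesis by simp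
qed

text \<open>The coefficients \<open>F\<^sup>-\<^sup>1 \<partial>\<^sub>a F\<close> of a flat connection on the tangent bundle. As the adjoint
  connection differentiates along its first argument, the direction of differentiation is the
  \<^emph>\<open>last\<close> index, the frame index \<open>a\<close>, while the form index \<open>\<mu>\<close> of the
  \<open>TU\<close>-connection becomes a matrix index.\<close>

definition pure_gauge :: "(real^'n \<Rightarrow> real^'n^'n) \<Rightarrow> nat \<Rightarrow> 'n \<Rightarrow> nat \<Rightarrow> real^'n \<Rightarrow> real" where
  "pure_gauge F b \<mu> a x = (matrix_inv (F x) ** partial (h a) F x) $ h b $ \<mu>"

lemma smooth_pure_gauge:
  assumes "open S" "smooth_on S F" "\<And>x. x \<in> S \<Longrightarrow> invertible (F x)"
  shows "smooth_on S (pure_gauge F b \<mu> a)"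
  unfolding pure_gauge_def[abs_def] matrix_matrix_mult_def vec_lambda_beta
  by (rule smooth_on_sum[OF assms(1)], rule smooth_on_mult[OF assms(1)],
      rule smooth_on_matrix_inv[OF assms], assumption,
      rule smooth_on_nth[OF assms(1)], rule smooth_on_nth[OF assms(1)],
      rule smooth_on_partial[OF assms(2)])

text \<open>With vanishing \<open>\<Omega>\<^sup>-\<close> (the case of a constant \<open>F\<close>) the equation reads
  \<open>\<partial>\<^sub>a E = E \<Omega>\<^sup>+\<^sub>a\<close>, which determines \<open>\<Omega>\<^sup>+\<close>.\<close>

lemma generalised_killing_pure_gauge:
  assumes "\<And>x. x \<in> S \<Longrightarrow> invertible (E x)"
  shows "generalised_killing S CARD('n) frame E (pure_gauge E) (pure_gauge (\<lambda>x. Finite_Cartesian_Product.mat 1))"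
  unfolding generalised_killing_def
proof (intro allI impI ballI)
  fix a x \<mu> \<nu> assume a: "a < CARD('n)" and x: "x \<in> S"
  let ?D = "partial (h a) E x"
  let ?W = "matrix_inv (E x) ** ?D"
  have "(\<Sum>\<sigma>\<in>UNIV. \<Sum>b<CARD('n). E x $ \<mu> $ \<sigma> * frame b x $ \<sigma> * pure_gauge E b \<nu> a x) =
      (\<Sum>\<sigma>\<in>UNIV. \<Sum>j\<in>UNIV. E x $ \<mu> $ \<sigma> * axis j 1 $ \<sigma> * ?W $ j $ \<nu>)"
    unfolding frame_def pure_gauge_def by (rule sum.cong[OF refl], rule sum_h)
  also have "\<dots> = (\<Sum>\<sigma>\<in>UNIV. E x $ \<mu> $ \<sigma> * ?W $ \<sigma> $ \<nu>)"
    by (simp add: axis_def if_distrib[of "\<lambda>t. t * _"] if_distrib[of "\<lambda>t. _ * t"] cong: if_cong)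
  also have "\<dots> = (E x ** ?W) $ \<mu> $ \<nu>"
    by (simp add: matrix_matrix_mult_def[of "E x"])
  also have "\<dots> = ?D $ \<mu> $ \<nu>"
    by (simp add: matrix_mul_assoc matrix_inv_right[OF assms[OF x]])
  finally show "lie_derivative2 (frame a) E x $ \<mu> $ \<nu> =
      (\<Sum>\<sigma>\<in>UNIV. \<Sum>b<CARD('n). E x $ \<mu> $ \<sigma> * frame b x $ \<sigma> * pure_gauge E b \<nu> a x) +
      (\<Sum>\<sigma>\<in>UNIV. \<Sum>b<CARD('n). E x $ \<sigma> $ \<nu> * frame b x $ \<sigma> *
        pure_gauge (\<lambda>x. Finite_Cartesian_Product.mat 1) b \<mu> a x)"
    by (simp add: lie_derivative_frame pure_gauge_def partial_const)
qed

lemma bounded_bilinear_matrix_vector_mult: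
  "bounded_bilinear ((*v) :: real^'n^'n \<Rightarrow> real^'n \<Rightarrow> real^'n)"
  unfolding bilinear_conv_bounded_bilinear[symmetric] bilinear_def
  by (auto intro!: linearI simp: matrix_vector_mult_def vec_eq_iff sum.distrib
      distrib_left distrib_right sum_distrib_left mult_ac)

text \<open>The terms differentiating \<open>q\<close> cancel between the \<open>TU\<close>-connection and the bracket; what
  remains, \<open>q(r) + F\<^sup>-\<^sup>1 q(F) r\<close>, is \<open>F\<^sup>-\<^sup>1 q(F r)\<close> by the product rule.\<close>

lemma adjoint_conn_pure_gauge:
  assumes "open S" "smooth_on S F" "\<And>x. x \<in> S \<Longrightarrow> invertible (F x)"
    and r: "smooth_section S CARD('n) r" and x: "x \<in> S" and a: "a < CARD('n)"
  shows "adjoint_conn CARD('n) frame (\<lambda>c a b x. 0) (pure_gauge F) q r a x =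
    (matrix_inv (F x) *v frechet_derivative (\<lambda>y. F y *v vec_of r y) (at x) (vec_of q x)) $ h a"
proof -
  let ?F' = "frechet_derivative F (at x)" and ?r' = "frechet_derivative (vec_of r) (at x)"
  let ?I = "matrix_inv (F x)" and ?q = "vec_of q x" and ?r = "vec_of r x"
  have F': "(F has_derivative ?F') (at x)"
    by (rule smooth_on_has_derivative[OF assms(2) x])
  have r': "(vec_of r has_derivative ?r') (at x)"
    by (rule smooth_on_has_derivative[OF smooth_on_vec_of[OF assms(1) r] x])
  have deriv: "frechet_derivative (\<lambda>y. F y *v vec_of r y) (at x) ?q = F x *v ?r' ?q + ?F' ?q *v ?r"
    by (rule frechet_derivative_eq[OF bounded_bilinear.FDERIV[OF bounded_bilinear_matrix_vector_mult F' r']])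
  have gauge: "(\<Sum>b<CARD('n). pure_gauge F a \<mu> b x * q b x) = (?I ** ?F' ?q) $ h a $ \<mu>" for \<mu>
  proof -
    have "(\<Sum>b<CARD('n). pure_gauge F a \<mu> b x * q b x) = (\<Sum>b<CARD('n). (?I ** partial (h b) F x) $ h a $ \<mu> * ?q $ h b)"
      by (simp add: pure_gauge_def vec_of_nth)
    also have "\<dots> = (\<Sum>i\<in>UNIV. (?I ** partial i F x) $ h a $ \<mu> * ?q $ i)"
      by (rule sum_h)
    also have "\<dots> = (\<Sum>i\<in>UNIV. \<Sum>j\<in>UNIV. ?I $ h a $ j * (?q $ i * partial i F x $ j $ \<mu>))"
      by (simp add: matrix_matrix_mult_def sum_distrib_left sum_distrib_right mult_ac)
    also have "\<dots> = (\<Sum>j\<in>UNIV. \<Sum>i\<in>UNIV. ?I $ h a $ j * (?q $ i * partial i F x $ j $ \<mu>))"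
      by (rule sum.swap)
    also have "\<dots> = (?I ** (\<Sum>i\<in>UNIV. ?q $ i *\<^sub>R partial i F x)) $ h a $ \<mu>"
      by (simp add: matrix_matrix_mult_def sum_distrib_left)
    finally show ?thesis by (simp add: has_derivative_sum_partial[OF F'])
  qed
  have "adjoint_conn CARD('n) frame (\<lambda>c a b x. 0) (pure_gauge F) q r a x =
      (\<Sum>\<mu>\<in>UNIV. ?q $ \<mu> * partial \<mu> (r a) x) + (\<Sum>\<mu>\<in>UNIV. ?r $ \<mu> * (?I ** ?F' ?q) $ h a $ \<mu>)"
    by (simp add: adjoint_conn_def TU_conn_def Q_bracket_def anchor_frame gauge
        distrib_left sum.distrib sum_subtractf)
  also have "(\<Sum>\<mu>\<in>UNIV. ?q $ \<mu> * partial \<mu> (r a) x) = ?r' ?q $ h a"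
    by (rule directional_derivative_section[OF r' a])
  also have "?r' ?q = ?I *v (F x *v ?r' ?q)"
    by (simp add: matrix_vector_mul_assoc matrix_inv_left[OF assms(3)[OF x]])
  also have "(\<Sum>\<mu>\<in>UNIV. ?r $ \<mu> * (?I ** ?F' ?q) $ h a $ \<mu>) = (?I *v (?F' ?q *v ?r)) $ h a"
    by (simp add: matrix_vector_mul_assoc matrix_vector_mult_def[of "?I ** ?F' ?q"] mult.commute)
  finally show ?thesis by (simp add: deriv matrix_vector_right_distrib)
qed

text \<open>Applying the connection twice, the \<open>F\<^sup>-\<^sup>1\<close> produced by the inner application cancels the
  \<open>F\<close> inserted by the outer one, which leaves
  \<open>F\<^sup>-\<^sup>1 q\<^sub>1(q\<^sub>2(F q\<^sub>3))\<close>; the curvature is thus the conjugate by \<open>F\<close> of that of plain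
  differentiation.\<close>

lemma flat_pure_gauge:
  assumes "open S" "smooth_on S F" "\<And>x. x \<in> S \<Longrightarrow> invertible (F x)"
  shows "flat_Q_conn S CARD('n) (Q_bracket CARD('n) frame (\<lambda>c a b x. 0))
    (adjoint_conn CARD('n) frame (\<lambda>c a b x. 0) (pure_gauge F))"
  unfolding flat_Q_conn_def
proof (intro allI impI ballI, elim conjE)
  fix q1 q2 q3 :: "'n sect" and a x
  assume q: "smooth_section S CARD('n) q1" "smooth_section S CARD('n) q2" "smooth_section S CARD('n) q3"
    and a: "a < CARD('n)" and x: "x \<in> S"
  let ?D = "adjoint_conn CARD('n) frame (\<lambda>c a b x. 0) (pure_gauge F)"
  let ?br = "Q_bracket CARD('n) frame (\<lambda>c a b x. 0) q1 q2"
  define P where "P y = F y *v vec_of q3 y" for y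
  have D: "?D p r b y = (matrix_inv (F y) *v
      frechet_derivative (\<lambda>z. F z *v vec_of r z) (at y) (vec_of p y)) $ h b"
    if "smooth_section S CARD('n) r" "y \<in> S" "b < CARD('n)" for p r b y
    by (rule adjoint_conn_pure_gauge[OF assms(1,2) _ that]) (rule assms(3))
  note vec = smooth_on_vec_of[OF assms(1)]
  have P: "smooth_on S P"
    unfolding P_def[abs_def]
    by (rule bounded_bilinear.smooth_on_prod[OF bounded_bilinear_matrix_vector_mult assms(1,2) vec[OF q(3)]])
  have D3: "?D p q3 b y = (matrix_inv (F y) *v frechet_derivative P (at y) (vec_of p y)) $ h b"
    if "y \<in> S" "b < CARD('n)" for p b y
    using D[OF q(3) that, of p] by (simp add: P_def[abs_def])
  have smooth: "smooth_section S CARD('n) (?D p q3)" if p: "smooth_section S CARD('n) p" for p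
    unfolding smooth_section_def
  proof (intro allI impI)
    fix b assume b: "b < CARD('n)"
    have "smooth_on S (\<lambda>y. \<Sum>j\<in>UNIV. matrix_inv (F y) $ h b $ j *
        frechet_derivative P (at y) (vec_of p y) $ j)"
      by (rule smooth_on_sum[OF assms(1)], rule smooth_on_mult[OF assms(1)],
          rule smooth_on_matrix_inv[OF assms], assumption, rule smooth_on_nth[OF assms(1)],
          rule smooth_on_directional_derivative[OF assms(1) P vec[OF p]])
    then show "smooth_on S (?D p q3 b)"
      by (rule smooth_on_cong[OF assms(1)]) (simp add: D3 b matrix_vector_mult_def)
  qed
  have F_D: "F y *v vec_of (?D p q3) y = frechet_derivative P (at y) (vec_of p y)"
    if y: "y \<in> S" for p y
  proof -
    have "vec_of (?D p q3) y $ i = (matrix_inv (F y) *v frechet_derivative P (at y) (vec_of p y)) $ i" for i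
    proof -
      obtain b where "b < CARD('n)" "i = h b"
        using bij by (auto simp: bij_betw_def)
      then show ?thesis using D3[OF y] by (simp add: vec_of_nth)
    qed
    then have "vec_of (?D p q3) y = matrix_inv (F y) *v frechet_derivative P (at y) (vec_of p y)"
      by (simp add: vec_eq_iff)
    then show ?thesis
      by (simp add: matrix_vector_mul_assoc matrix_inv_right[OF assms(3)[OF y]])
  qed
  have DD: "?D p (?D p' q3) a x = (matrix_inv (F x) *v
      frechet_derivative (\<lambda>y. frechet_derivative P (at y) (vec_of p' y)) (at x) (vec_of p x)) $ h a"
    if p': "smooth_section S CARD('n) p'" for p p'
  proof -
    have "smooth_on S (\<lambda>y. frechet_derivative P (at y) (vec_of p' y))"
      by (rule smooth_on_directional_derivative[OF assms(1) P vec[OF p']])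
    from smooth_on_has_derivative[OF this x]
    have "((\<lambda>y. F y *v vec_of (?D p' q3) y) has_derivative
        frechet_derivative (\<lambda>y. frechet_derivative P (at y) (vec_of p' y)) (at x)) (at x)"
      by (rule has_derivative_transform_within_open[OF _ assms(1) x]) (simp add: F_D)
    from frechet_derivative_eq[OF this] show ?thesis
      using D[OF smooth[OF p'] x a, of p] by simp
  qed
  have br: "vec_of ?br x = frechet_derivative (vec_of q2) (at x) (vec_of q1 x) -
      frechet_derivative (vec_of q1) (at x) (vec_of q2 x)"
  proof -
    have "vec_of ?br x $ i = (frechet_derivative (vec_of q2) (at x) (vec_of q1 x) -
      frechet_derivative (vec_of q1) (at x) (vec_of q2 x)) $ i" for i
    proof -
      obtain b where b: "b < CARD('n)" "i = h b"
        using bij by (auto simp: bij_betw_def)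
      show ?thesis
        using directional_derivative_section[OF smooth_on_has_derivative[OF vec[OF q(1)] x] b(1)]
          directional_derivative_section[OF smooth_on_has_derivative[OF vec[OF q(2)] x] b(1)]
        by (simp add: b(2) vec_of_nth[OF b(1)] Q_bracket_def anchor_frame sum_subtractf)
    qed
    then show ?thesis by (simp add: vec_eq_iff)
  qed
  have "?D q1 (?D q2 q3) a x - ?D q2 (?D q1 q3) a x = (matrix_inv (F x) *v
      (frechet_derivative (\<lambda>y. frechet_derivative P (at y) (vec_of q2 y)) (at x) (vec_of q1 x) -
       frechet_derivative (\<lambda>y. frechet_derivative P (at y) (vec_of q1 y)) (at x) (vec_of q2 x))) $ h a"
    by (simp add: DD q matrix_vector_mult_diff_distrib)
  also have "\<dots> = ?D ?br q3 a x"
    by (simp add: commutator_directional_derivatives[OF assms(1) P vec[OF q(1)] vec[OF q(2)] x]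
        D3[OF x a] br)
  finally show "?D q1 (?D q2 q3) a x - ?D q2 (?D q1 q3) a x - ?D ?br q3 a x = 0" by simp
qed

lemma gauging_data_frame:
  assumes "open S" "smooth_on S E" "\<And>x. x \<in> S \<Longrightarrow> invertible (E x)"
  defines "\<Omega>p \<equiv> pure_gauge E" and "\<Omega>m \<equiv> pure_gauge (\<lambda>x. Finite_Cartesian_Product.mat 1)"
  shows "gauging_data S E CARD('n) frame
    (adjoint_coeff frame (\<lambda>c a b x. 0) \<Omega>p) (adjoint_coeff frame (\<lambda>c a b x. 0) \<Omega>m)"
proof -
  have one: "smooth_on S (\<lambda>x. Finite_Cartesian_Product.mat 1 :: real^'n^'n)"
      "invertible (Finite_Cartesian_Product.mat 1 :: real^'n^'n)"
    by (auto simp: smooth_on_const invertible_def intro!: exI[of _ "Finite_Cartesian_Product.mat 1"])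
  have smooth: "smooth_on S (\<Omega>p a \<mu> b)" "smooth_on S (\<Omega>m a \<mu> b)" for a \<mu> b
    unfolding \<Omega>p_def \<Omega>m_def using smooth_pure_gauge assms(1-3) one by blast+
  have coeff: "smooth_on S (adjoint_coeff frame (\<lambda>c a b x. 0) \<Omega> a b c)"
    if "\<And>\<mu>. smooth_on S (\<Omega> a \<mu> b)" for \<Omega> and a b c
    unfolding adjoint_coeff_def[abs_def] frame_def
    by (rule smooth_on_add[OF assms(1) smooth_on_sum[OF assms(1) smooth_on_mult[OF assms(1)]]])
      (rule smooth_on_const that)+
  have "flat_Q_conn S CARD('n) (Q_bracket CARD('n) frame (\<lambda>c a b x. 0)) (adjoint_conn CARD('n) frame (\<lambda>c a b x. 0) \<Omega>p)"
      "flat_Q_conn S CARD('n) (Q_bracket CARD('n) frame (\<lambda>c a b x. 0)) (adjoint_conn CARD('n) frame (\<lambda>c a b x. 0) \<Omega>m)"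
    unfolding \<Omega>p_def \<Omega>m_def using flat_pure_gauge assms(1-3) one by blast+
  moreover have "generalised_killing S CARD('n) frame E \<Omega>p \<Omega>m"
    unfolding \<Omega>p_def \<Omega>m_def by (rule generalised_killing_pure_gauge[OF assms(3)])
  moreover have "Psi_condition S CARD('n) frame (\<lambda>c a b x. 0) E"
    by (rule Psi_condition_frame[OF assms(3)])
  ultimately show ?thesis
    unfolding gauging_data_def
    by (intro conjI exI[of _ "\<lambda>c a b x. 0"] exI[of _ \<Omega>p] exI[of _ \<Omega>m] allI impI ballI refl
        smooth coeff smooth_frame linearly_independent_frame involutive_frame)
qed

end

theorem corollary6p1:
  fixes M :: "'m topology"
    and A :: "('m, 'n::finite) chart set"
    and E :: "('m, 'n) tensor2"
  assumes "smooth_manifold M A"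
    and "topspace M \<noteq> {}"
    and "sigma_model_background A E"
    and "invertible_field A E"
  shows "locally_gauged A E"
proof -
  obtain c where c: "c \<in> A" "fst c \<noteq> {}"
    using assms(1,2) unfolding smooth_manifold_def by blast
  have "open (chart_range c)"
    using assms(1) c(1) unfolding smooth_manifold_def is_chart_def by blast
  moreover have "smooth_on (chart_range c) (E c)"
    using assms(3) c(1) unfolding sigma_model_background_def tensor_field2_def by blast
  moreover have "\<And>x. x \<in> chart_range c \<Longrightarrow> invertible (E c x)"
    using assms(4) c(1) unfolding invertible_field_def by blast
  moreover obtain h :: "nat \<Rightarrow> 'n" where h: "bij_betw h {..<CARD('n)} UNIV"
    using ex_bij_betw_nat_finite[OF finite_class.finite_UNIV] by (auto simp: atLeast0LessThan)
  moreover have "CARD('n) \<ge> 1"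
    by (simp add: Suc_leI)
  ultimately show ?thesis
    unfolding locally_gauged_def
    using c coordinate_frame.gauging_data_frame[OF coordinate_frame.intro[OF h]] by blast
qed

end
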